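(* Let $A\in\mathbb{R}^{m\times n}$, $\bar x\in\mathbb{R}^n$, $\bar y=|A\bar x|^2$, and let $\mathcal S_{\bar y,0}$ be the set of minimizers of the problem $$\inf_{x\in\mathbb{R}^n} R(x)\quad\text{subject to}\quad |Ax|=\sqrt{\bar y}.$$ Suppose that $\mathcal S_{\bar y,0}\neq\emptyset$, and that: (1) $R:\mathbb{R}^n\to\mathbb{R}\cup\{+\infty\}$ is proper, lower semicontinuous and convex, and is even ($R(-x)=R(x)$ for all $x$); (2) for every $I\subset\{1,\dots,m\}$ with $|I|\ge m/2$, $\ker(A^I)\cap\mathcal D_R(\bar x)=\{0\}$. Then the recovery of $\bar x$ up to a global sign is exact, i.e. $$\mathcal S_{\bar y,0}=\{\bar x,-\bar x\}.$$
   Context: For vectors, $|\cdot|$, squares and square roots are componentwise. $A^I$ is the submatrix of $A$ whose rows are those indexed by $I$. The descent cone of $R$ at $\bar x$ is $\mathcal D_R(\bar x)=\bigcup_{t>0}\{z\in\mathbb{R}^n : R(\bar x+tz)\le R(\bar x)\}$. *)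

theory Defs
  imports "HOL-Analysis.Analysis"
begin

(* On real ^ 'm the library operations abs and power act componentwise; only the
   componentwise square root has to be added. *)
definition vec_sqrt :: "real ^ 'm \<Rightarrow> real ^ 'm" where
  "vec_sqrt y = (\<chi> i. sqrt (y $ i))"

(* Extended-real-valued functions take values in ereal; properness includes that the value
   - \<infinity> is not attained, so that the codomain is R together with + \<infinity>. *)
definition proper_fun :: "('a \<Rightarrow> ereal) \<Rightarrow> bool" where
  "proper_fun f \<longleftrightarrow> (\<forall>x. f x \<noteq> -\<infinity>) \<and> (\<exists>x. f x \<noteq> \<infinity>)"

definition lsc_fun :: "('a::topological_space \<Rightarrow> ereal) \<Rightarrow> bool" where
  "lsc_fun f \<longleftrightarrow> (\<forall>x. f x \<le> Liminf (at x) f)"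

(* The library's convex_on is for real-valued functions only.  Here 0 * \<infinity> = 0 in ereal,
   so the inequality is trivial for weights 0 and 1. *)
definition convex_fun :: "('a::real_vector \<Rightarrow> ereal) \<Rightarrow> bool" where
  "convex_fun f \<longleftrightarrow> (\<forall>x y u v. 0 \<le> u \<longrightarrow> 0 \<le> v \<longrightarrow> u + v = 1 \<longrightarrow>
     f (u *\<^sub>R x + v *\<^sub>R y) \<le> ereal u * f x + ereal v * f y)"

definition even_fun :: "('a::uminus \<Rightarrow> 'b) \<Rightarrow> bool" where
  "even_fun f \<longleftrightarrow> (\<forall>x. f (- x) = f x)"

definition descent_cone :: "('a::real_vector \<Rightarrow> ereal) \<Rightarrow> 'a \<Rightarrow> 'a set" where
  "descent_cone f x = (\<Union>t\<in>{0<..}. {z. f (x + t *\<^sub>R z) \<le> f x})"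

(* A matrix whose rows are indexed by a set I (rather than by a type) is represented by the
   family of its rows, undefined outside I.  The kernel of a matrix with no rows is the whole
   space. *)
definition row_submatrix :: "real ^ 'n ^ 'm \<Rightarrow> 'm set \<Rightarrow> 'm \<Rightarrow> real ^ 'n" where
  "row_submatrix A I = (\<lambda>i\<in>I. row i A)"

definition rows_kernel :: "'m set \<Rightarrow> ('m \<Rightarrow> real ^ 'n) \<Rightarrow> (real ^ 'n) set" where
  "rows_kernel I B = {z. \<forall>i\<in>I. B i \<bullet> z = 0}"

definition solution_set ::
  "(real ^ 'n \<Rightarrow> ereal) \<Rightarrow> real ^ 'n ^ 'm \<Rightarrow> real ^ 'm \<Rightarrow> (real ^ 'n) set" where
  "solution_set R A y = {x. is_arg_min R (\<lambda>x. \<bar>A *v x\<bar> = vec_sqrt y) x}"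

end

theory Submission
  imports Defs
begin

text \<open>
  If $|Ax| = |A\bar x|$, then $Ax$ agrees with $A\bar x$ or with $-A\bar x$ on at least half of the
  rows. So one of $x - \bar x$, $-x - \bar x$ lies in the kernel of such a submatrix, and for a
  minimizer $x$ both lie in the descent cone, since $\bar x$ is feasible and $R$ is even. Hence
  every minimizer is $\bar x$ or $-\bar x$, and by evenness both are minimizers once one is.
\<close>

text \<open>Turns the constraint of the problem into
  \<open>\<bar>A *v x\<bar> = \<bar>A *v xbar\<bar>\<close>.\<close>

lemma vec_sqrt_power2: "vec_sqrt (\<bar>v\<bar> ^ 2) = \<bar>v\<bar>"
  by (simp add: vec_sqrt_def vec_eq_iff abs_vec_def power2_eq_square)

lemma diff_mem_rows_kernel_iff:
  "x - y \<in> rows_kernel I (row_submatrix A I) \<longleftrightarrow> (\<forall>i\<in>I. (A *v x) $ i = (A *v y) $ i)"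
  by (simp add: rows_kernel_def row_submatrix_def matrix_vector_mul_component row_def
      vec_lambda_eta inner_diff_right)

lemma diff_mem_descent_cone:
  assumes "f x \<le> f y"
  shows "x - y \<in> descent_cone f y"
  \<comment> \<open>The scale \<open>t = 1\<close> suffices, as
    \<open>y + (x - y) = x\<close>.\<close>
  unfolding descent_cone_def using assms by (auto intro!: bexI[of _ 1])

text \<open>The two cardinalities add up to at least \<open>CARD('m)\<close>, so they cannot both be
  below half of it.\<close>

lemma card_covering_halves:
  fixes I J :: "'m::finite set"
  assumes "I \<union> J = UNIV"
  shows "real (card I) \<ge> real CARD('m) / 2 \<or> real (card J) \<ge> real CARD('m) / 2"
  using card_Un_le[of I J] assms by simp linarith

theorem theorem3p4:
  fixes A :: "real ^ 'n ^ 'm"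
    and xbar :: "real ^ 'n"
    and ybar :: "real ^ 'm"
    and R :: "real ^ 'n \<Rightarrow> ereal"
  assumes ybar: "ybar = \<bar>A *v xbar\<bar> ^ 2"
    and nonempty: "solution_set R A ybar \<noteq> {}"
    and R_proper: "proper_fun R"
    and R_lsc: "lsc_fun R"
    and R_convex: "convex_fun R"
    and R_even: "even_fun R"
    and kernel: "\<And>I :: 'm set. real (card I) \<ge> real CARD('m) / 2 \<Longrightarrow>
      rows_kernel I (row_submatrix A I) \<inter> descent_cone R xbar = {0}"
  shows "solution_set R A ybar = {xbar, - xbar}"
proof -
  have sol_iff: "x \<in> solution_set R A ybar \<longleftrightarrow>
      \<bar>A *v x\<bar> = \<bar>A *v xbar\<bar> \<and> (\<forall>y. \<bar>A *v y\<bar> = \<bar>A *v xbar\<bar> \<longrightarrow> R x \<le> R y)" for x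
    by (auto simp: solution_set_def is_arg_min_def ybar vec_sqrt_power2 not_less)
  have even: "R (- x) = R x" for x
    using R_even by (simp add: even_fun_def)
  have abs_uminus: "\<bar>A *v (- x)\<bar> = \<bar>A *v x\<bar>" for x
    by (simp add: vec_eq_iff abs_vec_def matrix_vector_mult_def sum_negf)
  have uminus_sol: "- x \<in> solution_set R A ybar" if "x \<in> solution_set R A ybar" for x
    using that by (simp add: sol_iff even abs_uminus)
  \<comment> \<open>Here \<open>x - xbar\<close> lies in both the kernel and the descent cone, hence
    is 0.\<close>
  have eq_if_agree: "x = xbar"
    if "real (card I) \<ge> real CARD('m) / 2" "R x \<le> R xbar" "\<forall>i\<in>I. (A *v x) $ i = (A *v xbar) $ i"
    for x I
    using kernel[OF that(1)] diff_mem_descent_cone[of R, OF that(2)] that(3)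
      diff_mem_rows_kernel_iff[of x xbar I A]
    by (metis IntI eq_iff_diff_eq_0 singletonD)
  have sol_cases: "x = xbar \<or> - x = xbar" if x: "x \<in> solution_set R A ybar" for x
  proof -
    have le: "R x \<le> R xbar" and le': "R (- x) \<le> R xbar"
      using x by (auto simp: sol_iff even)
    let ?I = "{i. (A *v x) $ i = (A *v xbar) $ i}"
    \<comment> \<open>The rows of opposite sign, written as agreement for \<open>- x\<close> so that
      \<open>eq_if_agree\<close> applies to \<open>- x\<close> as well. Rows where both entries
      vanish lie in both sets.\<close>
    let ?J = "{i. (A *v (- x)) $ i = (A *v xbar) $ i}"
    have neg: "(A *v (- x)) $ i = - (A *v x) $ i" for i
      by (simp add: matrix_vector_mult_def sum_negf)
    have "\<bar>(A *v x) $ i\<bar> = \<bar>(A *v xbar) $ i\<bar>" for i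
      using x by (simp add: sol_iff abs_vec_def vec_eq_iff)
    then have "?I \<union> ?J = UNIV"
      by (simp add: neg abs_eq_iff set_eq_iff) (metis minus_minus)
    then show ?thesis
      using card_covering_halves[of ?I ?J] eq_if_agree[OF _ le, of ?I] eq_if_agree[OF _ le', of ?J]
      by blast
  qed
  from nonempty obtain x where x: "x \<in> solution_set R A ybar"
    by blast
  \<comment> \<open>Feasibility alone does not make \<open>xbar\<close> optimal; it is the known
    minimizer \<open>x\<close> or its negative.\<close>
  have "xbar \<in> solution_set R A ybar"
    using sol_cases[OF x] x uminus_sol[OF x] by auto
  then show ?thesis
    using sol_cases uminus_sol by force
qed

end
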